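(* Consider the two-stage program (DTS) and the single-level mixed-integer program (MILP-DB) over a decision diagram $\mathcal{D}^F=(\mathcal{N},\mathcal{A},\nu,l)$ encoding the follower's problem, both described in the context. The following are valid values for the big-M constants in (MILP-DB): $$M_a=l_a+\sum_{j=1}^n\max\{c^F_j,0\}-\sum_{j=1}^n\min\{c^F_j,0\},\qquad\forall a\in\mathcal{A}.$$ That is, with these constants (MILP-DB) is a valid reformulation of (DTS).
   Context: (DTS) is $$\max_{x^L,x^F}\ \sum_{j=1}^n(c^L_{1j}x^L_j+c^L_{2j}x^F_j)\ \text{ s.t. } A^Lx^L+B^Lx^F\le b^L,\ \ x^F\in\arg\max_{\overline{x}^F\in\{0,1\}^n}\Big\{\sum_j c^F_j\overline{x}^F_j: A^F\overline{x}^F\le b^F,\ \overline{x}^F\le\mathbf{1}-x^L\Big\},\ \ x^L\in\{0,1\}^n,$$ with real data of appropriate dimensions. It is assumed that for any feasible leader solution there exists a feasible follower response (relatively complete recourse). A decision diagram with $n\ge 1$ variables is a finite acyclic directed (multi)graph (parallel arcs allowed) with node set $\mathcal{N}$ partitioned into layers $\mathcal{N}_1,\dots,\mathcal{N}_{n+1}$, $\mathcal{N}_1=\{\mathbf{r}\}$, $\mathcal{N}_{n+1}=\{\mathbf{t}\}$. Each arc $a\in\mathcal{A}$ goes from a tail node $t_a$ in some $\mathcal{N}_j$ to a head node $h_a\in\mathcal{N}_{j+1}$; $\tau_a:=j$. Arcs have values $\nu_a$ and lengths $l_a$. $\Gamma^+(u),\Gamma^-(u)$ are the arcs leaving/entering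 $u$. $\mathcal{D}^F$ encodes the follower's problem: $(a_1,\dots,a_n)\mapsto(\nu_{a_1},\dots,\nu_{a_n})$ is a one-to-one correspondence between $\mathbf{r}$-$\mathbf{t}$ paths and $\{x\in\{0,1\}^n:A^Fx\le b^F\}$ (arc values in $\{0,1\}$), with $l_a=c^F_{\tau_a}$ if $\nu_a=1$ and $l_a=0$ if $\nu_a=0$. (MILP-DB), for constants $M_a$, is: maximize $\sum_{j=1}^n (c^L_{1j}x^L_j+c^L_{2j}x^F_j)$ over $x^L,x^F\in\{0,1\}^n$, $y\in\{0,1\}^{|\mathcal{A}|}$, $\pi\in\mathbb{R}^{|\mathcal{N}|}$ with $\pi_{\mathbf{t}}=0$, and $\gamma_a\ge0$ (for $a$ with $\nu_a=1$), subject to - $A^Lx^L+B^Lx^F\le b^L$; - $\sum_{a\in\Gamma^+(\mathbf{r})}y_a=1$; $\ \sum_{a\in\Gamma^+(u)}y_a-\sum_{a\in\Gamma^-(u)}y_a=0$ for all $u\in\mathcal{N}\setminus\{\mathbf{r},\mathbf{t}\}$; - $y_a\le 1-x^L_{\tau_a}$ for all $a$ with $\nu_a=1$; - $\pi_{t_a}-\pi_{h_a}+\gamma_a\ge l_a$ for all $a$ with $\nu_a=1$; $\ \pi_{t_a}-\pi_{h_a}\ge0$ for all $a$ with $\nu_a=0$; - $x^F_j=\sum_{a:\tau_a=j,\nu_a=1}y_a$ for $j=1,\dots,n$; - $l^\top y-\pi_{\mathbf{r}}-\sum_{a:\nu_a=1}\gamma_a+\sum_{a:\nu_a=1}M_ax^L_{\tau_a}=0$;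 - $\gamma_a-M_ax^L_{\tau_a}\ge0$ for all $a$ with $\nu_a=1$. "Valid reformulation" means: a pair $(x^L,x^F)$ is feasible for (DTS) if and only if there exist $(y,\pi,\gamma)$ such that $(x^L,x^F,y,\pi,\gamma)$ is feasible for (MILP-DB) (the objectives being identical). *)

theory Defs
  imports "Jordan_Normal_Form.Matrix" "Graph_Theory.Arc_Walk"
begin

text \<open>
  Variables are indexed by \<open>0, \<dots>, n - 1\<close>, following \<^typ>\<open>real vec\<close>; accordingly the layers of a
  decision diagram are numbered \<open>0, \<dots>, n\<close>, and an arc leaving layer \<open>j\<close> decides variable \<open>j\<close>.
\<close>

section \<open>The discrete two-stage problem\<close>

definition binary_vecs :: "nat \<Rightarrow> real vec set" where
  "binary_vecs n = {x \<in> carrier_vec n. \<forall>j<n. x $ j \<in> {0, 1}}"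

record dts =
  nvars :: nat
  c1L :: "real vec"
  c2L :: "real vec"
  cF :: "real vec"
  AL :: "real mat"
  BL :: "real mat"
  bL :: "real vec"
  AF :: "real mat"
  bF :: "real vec"

definition dts_data :: "dts \<Rightarrow> bool" where
  "dts_data P \<longleftrightarrow>
     1 \<le> nvars P \<and>
     c1L P \<in> carrier_vec (nvars P) \<and> c2L P \<in> carrier_vec (nvars P) \<and> cF P \<in> carrier_vec (nvars P) \<and>
     AL P \<in> carrier_mat (dim_vec (bL P)) (nvars P) \<and>
     BL P \<in> carrier_mat (dim_vec (bL P)) (nvars P) \<and>
     AF P \<in> carrier_mat (dim_vec (bF P)) (nvars P)"

definition follower_set :: "dts \<Rightarrow> real vec set" where
  "follower_set P = {x \<in> binary_vecs (nvars P). AF P *\<^sub>v x \<le> bF P}"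

definition follower_responses :: "dts \<Rightarrow> real vec \<Rightarrow> real vec set" where
  "follower_responses P xL = {x \<in> follower_set P. x \<le> vec (nvars P) (\<lambda>_. 1) - xL}"

definition leader_constraints :: "dts \<Rightarrow> real vec \<Rightarrow> real vec \<Rightarrow> bool" where
  "leader_constraints P xL xF \<longleftrightarrow> AL P *\<^sub>v xL + BL P *\<^sub>v xF \<le> bL P"

definition dts_feasible :: "dts \<Rightarrow> real vec \<Rightarrow> real vec \<Rightarrow> bool" where
  "dts_feasible P xL xF \<longleftrightarrow>
     xL \<in> binary_vecs (nvars P) \<and>
     leader_constraints P xL xF \<and>
     is_arg_max (\<lambda>x. cF P \<bullet> x) (\<lambda>x. x \<in> follower_responses P xL) xF"

definition dts_objective :: "dts \<Rightarrow> real vec \<Rightarrow> real vec \<Rightarrow> real" where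
  "dts_objective P xL xF = (\<Sum>j<nvars P. c1L P $ j * xL $ j + c2L P $ j * xF $ j)"

text \<open>
  A leader solution counts as feasible if the leader's constraints can be satisfied together with
  some binary \<open>xF\<close>, not necessarily one the follower may choose.
\<close>

definition relatively_complete_recourse :: "dts \<Rightarrow> bool" where
  "relatively_complete_recourse P \<longleftrightarrow>
     (\<forall>xL \<in> binary_vecs (nvars P).
        (\<exists>xF \<in> binary_vecs (nvars P). leader_constraints P xL xF) \<longrightarrow> follower_responses P xL \<noteq> {})"

section \<open>Decision diagrams\<close>

record ('v, 'e) diagram =
  graph_of :: "('v, 'e) pre_digraph"
  layer :: "'v \<Rightarrow> nat"
  root :: 'v
  terminal :: 'v
  val :: "'e \<Rightarrow> real"
  len :: "'e \<Rightarrow> real"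

abbreviation nodes :: "('v, 'e) diagram \<Rightarrow> 'v set" where
  "nodes D \<equiv> verts (graph_of D)"

abbreviation darcs :: "('v, 'e) diagram \<Rightarrow> 'e set" where
  "darcs D \<equiv> arcs (graph_of D)"

abbreviation dtail :: "('v, 'e) diagram \<Rightarrow> 'e \<Rightarrow> 'v" where
  "dtail D \<equiv> tail (graph_of D)"

abbreviation dhead :: "('v, 'e) diagram \<Rightarrow> 'e \<Rightarrow> 'v" where
  "dhead D \<equiv> head (graph_of D)"

definition arc_layer :: "('v, 'e) diagram \<Rightarrow> 'e \<Rightarrow> nat" where
  "arc_layer D a = layer D (dtail D a)"

text \<open>Acyclicity follows from the layering condition on arcs.\<close>

definition decision_diagram :: "nat \<Rightarrow> ('v, 'e) diagram \<Rightarrow> bool" where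
  "decision_diagram n D \<longleftrightarrow>
     1 \<le> n \<and>
     fin_digraph (graph_of D) \<and>
     (\<forall>u \<in> nodes D. layer D u \<le> n) \<and>
     {u \<in> nodes D. layer D u = 0} = {root D} \<and>
     {u \<in> nodes D. layer D u = n} = {terminal D} \<and>
     (\<forall>a \<in> darcs D. layer D (dhead D a) = Suc (layer D (dtail D a)))"

definition encodes_follower :: "('v, 'e) diagram \<Rightarrow> dts \<Rightarrow> bool" where
  "encodes_follower D P \<longleftrightarrow>
     decision_diagram (nvars P) D \<and>
     (\<forall>a \<in> darcs D. val D a \<in> {0, 1}) \<and>
     bij_betw (\<lambda>p. vec_of_list (map (val D) p))
       {p. pre_digraph.apath (graph_of D) (root D) p (terminal D)} (follower_set P) \<and>
     (\<forall>a \<in> darcs D. len D a = (if val D a = 1 then cF P $ arc_layer D a else 0))"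

section \<open>The single-level reformulation\<close>

abbreviation one_arcs :: "('v, 'e) diagram \<Rightarrow> 'e set" where
  "one_arcs D \<equiv> {a \<in> darcs D. val D a = 1}"

abbreviation zero_arcs :: "('v, 'e) diagram \<Rightarrow> 'e set" where
  "zero_arcs D \<equiv> {a \<in> darcs D. val D a = 0}"

definition milp_db_feasible ::
  "dts \<Rightarrow> ('v, 'e) diagram \<Rightarrow> ('e \<Rightarrow> real) \<Rightarrow>
   real vec \<Rightarrow> real vec \<Rightarrow> ('e \<Rightarrow> real) \<Rightarrow> ('v \<Rightarrow> real) \<Rightarrow> ('e \<Rightarrow> real) \<Rightarrow> bool"
where
  "milp_db_feasible P D M xL xF y \<pi> \<gamma> \<longleftrightarrow>
     xL \<in> binary_vecs (nvars P) \<and> xF \<in> binary_vecs (nvars P) \<and>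
     (\<forall>a \<in> darcs D. y a \<in> {0, 1}) \<and>
     \<pi> (terminal D) = 0 \<and>
     (\<forall>a \<in> one_arcs D. 0 \<le> \<gamma> a) \<and>
     leader_constraints P xL xF \<and>
     (\<Sum>a \<in> out_arcs (graph_of D) (root D). y a) = 1 \<and>
     (\<forall>u \<in> nodes D - {root D, terminal D}.
        (\<Sum>a \<in> out_arcs (graph_of D) u. y a) - (\<Sum>a \<in> in_arcs (graph_of D) u. y a) = 0) \<and>
     (\<forall>a \<in> one_arcs D. y a \<le> 1 - xL $ arc_layer D a) \<and>
     (\<forall>a \<in> one_arcs D. \<pi> (dtail D a) - \<pi> (dhead D a) + \<gamma> a \<ge> len D a) \<and>
     (\<forall>a \<in> zero_arcs D. \<pi> (dtail D a) - \<pi> (dhead D a) \<ge> 0) \<and>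
     (\<forall>j<nvars P. xF $ j = (\<Sum>a \<in> {a \<in> one_arcs D. arc_layer D a = j}. y a)) \<and>
     (\<Sum>a \<in> darcs D. len D a * y a) - \<pi> (root D) - (\<Sum>a \<in> one_arcs D. \<gamma> a)
       + (\<Sum>a \<in> one_arcs D. M a * xL $ arc_layer D a) = 0 \<and>
     (\<forall>a \<in> one_arcs D. \<gamma> a - M a * xL $ arc_layer D a \<ge> 0)"

definition milp_db_objective ::
  "dts \<Rightarrow> real vec \<Rightarrow> real vec \<Rightarrow> ('e \<Rightarrow> real) \<Rightarrow> ('v \<Rightarrow> real) \<Rightarrow> ('e \<Rightarrow> real) \<Rightarrow> real"
where
  "milp_db_objective P xL xF y \<pi> \<gamma> = (\<Sum>j<nvars P. c1L P $ j * xL $ j + c2L P $ j * xF $ j)"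

definition valid_reformulation :: "dts \<Rightarrow> ('v, 'e) diagram \<Rightarrow> ('e \<Rightarrow> real) \<Rightarrow> bool" where
  "valid_reformulation P D M \<longleftrightarrow>
     (\<forall>xL xF. dts_feasible P xL xF \<longleftrightarrow> (\<exists>y \<pi> \<gamma>. milp_db_feasible P D M xL xF y \<pi> \<gamma>)) \<and>
     (\<forall>xL xF y \<pi> \<gamma>. milp_db_feasible P D M xL xF y \<pi> \<gamma> \<longrightarrow>
        milp_db_objective P xL xF y \<pi> \<gamma> = dts_objective P xL xF)"

definition big_M :: "dts \<Rightarrow> ('v, 'e) diagram \<Rightarrow> 'e \<Rightarrow> real" where
  "big_M P D a = len D a + (\<Sum>j<nvars P. max (cF P $ j) 0) - (\<Sum>j<nvars P. min (cF P $ j) 0)"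

end

theory Submission
  imports Defs
begin

text \<open>
  For a fixed leader decision \<open>xL\<close>, the follower looks for a longest root-terminal path that avoids
  the interdicted arcs, that is, the one-arcs in layers \<open>j\<close> with \<open>xL $ j = 1\<close>. The variables \<open>y\<close> of
  (MILP-DB) are a binary unit flow, hence the indicator of such a path
  (\<open>unit_flow_imp_walk\<close>, \<open>walk_unit_flow\<close>). The variables \<open>(\<pi>, \<gamma>)\<close> are dual: node potentials
  and prices for the interdiction constraints.

  From (MILP-DB) to (DTS): put \<open>s a = \<gamma> a - M a * xL $ j\<close> for each one-arc \<open>a\<close> leaving layer \<open>j\<close>;
  these slacks are nonnegative, and the strong duality equation says that the path of \<open>y\<close> has length
  \<open>\<pi> (root D)\<close> plus the sum of all slacks. On the one-arcs of a path that avoids interdicted arcs \<open>\<gamma>\<close> equals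
  \<open>s\<close>, so adding up the dual constraints along it
  (\<open>walk_weight_le_potential_drop\<close>) bounds its length by \<open>\<pi> (root D)\<close> plus the slacks it meets.
  Hence the path of \<open>y\<close> is longest.

  From (DTS) to (MILP-DB): choose \<open>\<gamma> a = M a * xL $ j\<close>, so that all slacks vanish. The
  dual constraints then ask for a potential with respect to the arc lengths in which an interdicted
  arc is shortened by \<open>M a\<close>, and the duality equation asks for the optimal follower value at
  the root. Such a potential exists as soon as no root-terminal path is
  longer, after shortening, than the optimal value (\<open>potential_exists\<close>). This is where the size of
  \<open>M\<close> matters: a shortened arc has length \<open>T - S\<close>, where \<open>S\<close> and \<open>T\<close> are the sums of the positive
  and of the negative parts of \<open>cF\<close>. The other arcs contribute at most \<open>S\<close>, so a path with an
  interdicted arc is no longer than \<open>T\<close> (\<open>penalised_walk_le_sum_min\<close>), while every binary vector,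
  in particular the optimal response, has follower value at least \<open>T\<close>.
\<close>

section \<open>Walks in a layered diagram\<close>

locale layered_diagram =
  fixes n :: nat and D :: "('v, 'e) diagram"
  assumes decision_diagram: "decision_diagram n D"
begin

sublocale fin_digraph "graph_of D"
  using decision_diagram by (simp add: decision_diagram_def)

lemma n_pos: "0 < n"
  and layer_le: "u \<in> nodes D \<Longrightarrow> layer D u \<le> n"
  and layer_head: "a \<in> darcs D \<Longrightarrow> layer D (dhead D a) = Suc (arc_layer D a)"
  using decision_diagram by (auto simp: decision_diagram_def arc_layer_def)

lemma layer_root: "layer D (root D) = 0"
  and layer_0_imp_root: "u \<in> nodes D \<Longrightarrow> layer D u = 0 \<Longrightarrow> u = root D"
  and terminal_in_nodes: "terminal D \<in> nodes D" and layer_terminal: "layer D (terminal D) = n"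
  and layer_n_imp_terminal: "u \<in> nodes D \<Longrightarrow> layer D u = n \<Longrightarrow> u = terminal D"
proof -
  have r: "{u \<in> nodes D. layer D u = 0} = {root D}"
    and t: "{u \<in> nodes D. layer D u = n} = {terminal D}"
    using decision_diagram by (auto simp: decision_diagram_def)
  have "root D \<in> {u \<in> nodes D. layer D u = 0}" unfolding r by simp
  then show "layer D (root D) = 0" by auto
  have "terminal D \<in> {u \<in> nodes D. layer D u = n}" unfolding t by simp
  then show "terminal D \<in> nodes D" "layer D (terminal D) = n" by auto
  show "u = root D" if "u \<in> nodes D" "layer D u = 0" using r that by blast
  show "u = terminal D" if "u \<in> nodes D" "layer D u = n" using t that by blast
qed

lemma root_neq_terminal: "root D \<noteq> terminal D"
  using n_pos layer_root layer_terminal by auto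

lemma arc_layer_less: "a \<in> darcs D \<Longrightarrow> arc_layer D a < n"
  using layer_head[of a] layer_le[OF head_in_verts, of a] by simp

text \<open>
  Each arc climbs exactly one layer, so the layers along a walk are consecutive integers.
  Every walk is therefore a path, and a root-terminal walk has exactly one arc per
  layer: its arc at position \<open>j\<close> is the one that decides variable \<open>j\<close>.
\<close>

lemma awalk_layers:
  assumes "awalk u p v"
  shows "layer D v = layer D u + length p"
    and "map (arc_layer D) p = [layer D u..<layer D u + length p]"
    and "map (layer D) (awalk_verts u p) = [layer D u..<Suc (layer D u + length p)]"
proof -
  have "layer D v = layer D u + length p \<and>
        map (arc_layer D) p = [layer D u..<layer D u + length p] \<and>
        map (layer D) (awalk_verts u p) = [layer D u..<Suc (layer D u + length p)]"
    using assms
  proof (induction p arbitrary: u)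
    case Nil
    then show ?case by (simp add: awalk_Nil_iff)
  next
    case (Cons a p)
    then have a: "a \<in> darcs D" "u = dtail D a" and p: "awalk (dhead D a) p v"
      by (auto simp: awalk_Cons_iff)
    have "layer D (dhead D a) = Suc (layer D u)"
      using layer_head[OF a(1)] a(2) by (simp add: arc_layer_def)
    with Cons.IH[OF p] a(2) show ?case
      by (simp add: arc_layer_def upt_conv_Cons del: upt_Suc)
  qed
  then show "layer D v = layer D u + length p"
    "map (arc_layer D) p = [layer D u..<layer D u + length p]"
    "map (layer D) (awalk_verts u p) = [layer D u..<Suc (layer D u + length p)]" by auto
qed

lemma awalk_distinct: "awalk u p v \<Longrightarrow> distinct p"
  by (metis awalk_layers(2) distinct_map distinct_upt)

lemma awalk_imp_apath: "awalk u p v \<Longrightarrow> apath u p v"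
  unfolding apath_def by (metis awalk_layers(3) distinct_map distinct_upt)

lemma apath_iff_awalk: "apath u p v \<longleftrightarrow> awalk u p v"
  using awalk_imp_apath by (auto simp: apath_def)

lemma finite_awalks: "finite {p. awalk u p v}"
  using apaths_finite[of u v] by (simp add: apath_iff_awalk)

lemma arc_in_walk: "awalk u p v \<Longrightarrow> a \<in> set p \<Longrightarrow> a \<in> darcs D"
  by (auto simp: awalk_def)

lemma length_root_terminal:
  assumes "awalk (root D) p (terminal D)" shows "length p = n"
  using awalk_layers(1)[OF assms] layer_root layer_terminal by simp

lemma arc_layer_nth:
  assumes "awalk (root D) p (terminal D)" "j < n"
  shows "arc_layer D (p ! j) = j"
  using awalk_layers(2)[OF assms(1)] assms(2) length_root_terminal[OF assms(1)] layer_root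
  by (metis add_0 length_map nth_map nth_upt)

lemma arc_of_layer:
  assumes "awalk (root D) p (terminal D)" "a \<in> set p"
  shows "a = p ! arc_layer D a"
proof -
  obtain i where "i < n" "a = p ! i"
    using assms length_root_terminal[OF assms(1)] by (auto simp: in_set_conv_nth)
  then show ?thesis using arc_layer_nth[OF assms(1)] by simp
qed

lemma nth_in_walk:
  assumes "awalk (root D) p (terminal D)" "j < n"
  shows "p ! j \<in> set p" "p ! j \<in> darcs D"
  using assms length_root_terminal[OF assms(1)] arc_in_walk[OF assms(1)] by auto

section \<open>Longest paths and node potentials\<close>

text \<open>Weak duality: the potential differences telescope along the walk.\<close>

lemma walk_weight_le_potential_drop:
  fixes w :: "'e \<Rightarrow> real"
  assumes "awalk u p v" and "\<And>a. a \<in> set p \<Longrightarrow> w a \<le> \<pi> (dtail D a) - \<pi> (dhead D a)"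
  shows "sum_list (map w p) \<le> \<pi> u - \<pi> v"
  using assms
proof (induction p arbitrary: u)
  case Nil
  then show ?case by (simp add: awalk_Nil_iff)
next
  case (Cons a p)
  then have "sum_list (map w p) \<le> \<pi> (dhead D a) - \<pi> v" by (auto simp: awalk_Cons_iff)
  moreover have "w a \<le> \<pi> u - \<pi> (dhead D a)" using Cons.prems by (auto simp: awalk_Cons_iff)
  ultimately show ?case by simp
qed

text \<open>
  Strong duality for longest paths, with a prescribed value at the root. The natural candidate for
  \<open>\<pi> u\<close> is the length of a longest path from \<open>u\<close> to the terminal, but there are two
  obstacles: nodes from which the terminal is unreachable have no such path, and the value at the root
  has to be exactly \<open>z\<close>. Both disappear if every node gets one extra candidate,
  \<open>z - C * layer D u\<close>. For \<open>C\<close> at least as large as every arc length this is itself a potential,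
  and the maximum of two potentials is a potential. At the root the extra candidate is \<open>z\<close>, which
  dominates all path lengths by assumption. At the terminal it is \<open>z - C * n\<close>, which is at
  most the length 0 of the empty path once also \<open>z \<le> C\<close>.
\<close>

lemma potential_exists:
  fixes w :: "'e \<Rightarrow> real"
  assumes bound: "\<And>p. awalk (root D) p (terminal D) \<Longrightarrow> sum_list (map w p) \<le> z"
  obtains \<pi> where "\<pi> (root D) = z" "\<pi> (terminal D) = 0"
    "\<And>a. a \<in> darcs D \<Longrightarrow> w a \<le> \<pi> (dtail D a) - \<pi> (dhead D a)"
proof -
  define C where "C = (\<Sum>a\<in>darcs D. \<bar>w a\<bar>) + \<bar>z\<bar>"
  have C_ge_w: "w a \<le> C" if "a \<in> darcs D" for a
    using member_le_sum[of a "darcs D" "\<lambda>a. \<bar>w a\<bar>"] that by (auto simp: C_def)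
  have C_ge_z: "z \<le> C" and C_nonneg: "0 \<le> C" by (auto simp: C_def sum_nonneg add_increasing)
  define V where
    "V u = insert (z - C * layer D u) ((\<lambda>p. sum_list (map w p)) ` {p. awalk u p (terminal D)})" for u
  have fin: "finite (V u)" for u by (simp add: V_def finite_awalks)
  have ne: "V u \<noteq> {}" for u by (simp add: V_def)
  define \<pi> where "\<pi> u = Max (V u)" for u
  show thesis
  proof
    show "\<pi> (root D) = z"
      unfolding \<pi>_def by (rule Max_eqI) (auto simp: fin, auto simp: V_def layer_root bound)
    have "z \<le> C * real n" 
      using C_ge_z C_nonneg n_pos mult_left_mono[of 1 "real n" C] by auto
    then show "\<pi> (terminal D) = 0"
      unfolding \<pi>_def
    proof (intro Max_eqI fin)
      have "awalk (terminal D) [] (terminal D)"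
        by (simp add: awalk_Nil_iff terminal_in_nodes)
      then show "0 \<in> V (terminal D)" unfolding V_def by force
      show "x \<le> 0" if "x \<in> V (terminal D)" "z \<le> C * real n" for x
        using that awalk_layers(1)[of "terminal D" _ "terminal D"]
        by (auto simp: V_def layer_terminal) fastforce
    qed
    fix a assume a: "a \<in> darcs D"
    have "w a + x \<le> \<pi> (dtail D a)" if x: "x \<in> V (dhead D a)" for x
    proof -
      consider "x = z - C * layer D (dhead D a)"
        | p where "awalk (dhead D a) p (terminal D)" "x = sum_list (map w p)"
        using x by (auto simp: V_def)
      then show ?thesis
      proof cases
        case 1
        have "z - C * layer D (dtail D a) \<le> \<pi> (dtail D a)"
          unfolding \<pi>_def by (rule Max_ge[OF fin]) (simp add: V_def)
        then show ?thesis using 1 C_ge_w[OF a] layer_head[OF a]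
          by (simp add: arc_layer_def algebra_simps)
      next
        case 2
        then have "awalk (dtail D a) (a # p) (terminal D)"
          using a by (simp add: awalk_Cons_iff)
        then have "sum_list (map w (a # p)) \<in> V (dtail D a)" unfolding V_def by blast
        then show ?thesis unfolding \<pi>_def using 2 Max_ge[OF fin] by simp
      qed
    qed
    from this[OF Max_in[OF fin ne]] show "w a \<le> \<pi> (dtail D a) - \<pi> (dhead D a)"
      by (simp add: \<pi>_def)
  qed
qed

section \<open>Binary unit flows\<close>

definition unit_flow :: "('e \<Rightarrow> real) \<Rightarrow> bool" where
  "unit_flow y \<longleftrightarrow>
     (\<forall>a \<in> darcs D. y a \<in> {0, 1}) \<and>
     (\<Sum>a \<in> out_arcs (graph_of D) (root D). y a) = 1 \<and>
     (\<forall>u \<in> nodes D - {root D, terminal D}.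
        (\<Sum>a \<in> out_arcs (graph_of D) u. y a) - (\<Sum>a \<in> in_arcs (graph_of D) u. y a) = 0)"

text \<open>
  Prepending an arc adds one unit of outflow at its tail and one unit of inflow at its
  head. Indicators may replace multiplicities because no walk repeats an arc.
\<close>

lemma walk_flow_balance:
  assumes "awalk s p e"
  shows "(\<Sum>a \<in> out_arcs (graph_of D) u. of_bool (a \<in> set p)) -
         (\<Sum>a \<in> in_arcs (graph_of D) u. of_bool (a \<in> set p)) =
         (of_bool (u = s) - of_bool (u = e) :: real)"
  using assms
proof (induction p arbitrary: s)
  case Nil
  then show ?case by (simp add: awalk_Nil_iff)
next
  case (Cons a p)
  then have a: "a \<in> darcs D" "s = dtail D a" and p: "awalk (dhead D a) p e"
    by (auto simp: awalk_Cons_iff)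
  have "a \<notin> set p" using awalk_distinct[OF Cons.prems] by simp
  then have split: "of_bool (b \<in> set (a # p)) = (if b = a then 1 else 0) + (of_bool (b \<in> set p) :: real)" for b
    by auto
  have "finite (out_arcs (graph_of D) u)" "finite (in_arcs (graph_of D) u)" by auto
  then show ?case
    using Cons.IH[OF p] a unfolding split sum.distrib
    by (auto simp: sum.delta in_out_arcs_conv split: if_splits)
qed

lemma walk_unit_flow:
  assumes "awalk (root D) p (terminal D)"
  shows "unit_flow (\<lambda>a. of_bool (a \<in> set p))"
proof -
  have "in_arcs (graph_of D) (root D) = {}"
    using layer_head layer_root by force
  then have "(\<Sum>a \<in> out_arcs (graph_of D) (root D). of_bool (a \<in> set p)) = (1 :: real)"
    using walk_flow_balance[OF assms, of "root D"] root_neq_terminal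
    by (simp del: sum_of_bool_eq)
  moreover have "(\<Sum>a \<in> out_arcs (graph_of D) u. of_bool (a \<in> set p)) -
      (\<Sum>a \<in> in_arcs (graph_of D) u. of_bool (a \<in> set p)) = (0 :: real)"
    if "u \<noteq> root D" "u \<noteq> terminal D" for u
    using walk_flow_balance[OF assms, of u] that by (simp del: sum_of_bool_eq)
  ultimately show ?thesis by (auto simp: unit_flow_def simp del: sum_of_bool_eq)
qed

lemma unit_flow_conservation:
  assumes "unit_flow y" "u \<in> nodes D" "0 < layer D u" "layer D u < n"
  shows "(\<Sum>a \<in> out_arcs (graph_of D) u. y a) = (\<Sum>a \<in> in_arcs (graph_of D) u. y a)"
proof -
  have "u \<in> nodes D - {root D, terminal D}" using assms layer_root layer_terminal by auto
  then show ?thesis using assms(1) by (simp add: unit_flow_def)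
qed

text \<open>
  The unit leaving the root passes through every layer, as conservation holds at all nodes
  strictly between the first and the last layer.
\<close>

lemma unit_flow_layer_sum:
  assumes y: "unit_flow y" and "j < n"
  shows "(\<Sum>a \<in> {a \<in> darcs D. arc_layer D a = j}. y a) = 1"
  using \<open>j < n\<close>
proof (induction j)
  case 0
  have "{a \<in> darcs D. arc_layer D a = 0} = out_arcs (graph_of D) (root D)"
    using layer_0_imp_root layer_root by (auto simp: arc_layer_def)
  then show ?case using y by (simp add: unit_flow_def)
next
  case (Suc j)
  let ?U = "{u \<in> nodes D. layer D u = Suc j}"
  have "(\<Sum>a \<in> {a \<in> darcs D. arc_layer D a = Suc j}. y a) =
        (\<Sum>u \<in> ?U. \<Sum>a \<in> {a \<in> {a \<in> darcs D. arc_layer D a = Suc j}. dtail D a = u}. y a)"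
    by (rule sum.group[symmetric]) (auto simp: arc_layer_def)
  also have "\<dots> = (\<Sum>u \<in> ?U. \<Sum>a \<in> out_arcs (graph_of D) u. y a)"
    by (intro sum.cong refl) (auto simp: arc_layer_def)
  also have "\<dots> = (\<Sum>u \<in> ?U. \<Sum>a \<in> in_arcs (graph_of D) u. y a)"
  proof (rule sum.cong[OF refl])
    fix u assume "u \<in> ?U"
    then show "(\<Sum>a \<in> out_arcs (graph_of D) u. y a) = (\<Sum>a \<in> in_arcs (graph_of D) u. y a)"
      using Suc.prems by (intro unit_flow_conservation[OF y]) simp_all
  qed
  also have "\<dots> = (\<Sum>u \<in> ?U. \<Sum>a \<in> {a \<in> {a \<in> darcs D. arc_layer D a = j}. dhead D a = u}. y a)"
    using layer_head by (intro sum.cong refl) auto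
  also have "\<dots> = (\<Sum>a \<in> {a \<in> darcs D. arc_layer D a = j}. y a)"
    by (rule sum.group) (auto simp: layer_head)
  finally show ?case using Suc by simp
qed

text \<open>
  A binary flow of total value one in each layer selects exactly one arc \<open>f j\<close> of layer \<open>j\<close>, and
  conservation at the head of \<open>f j\<close> forces that node to be the tail of \<open>f (Suc j)\<close>.
\<close>

lemma unit_flow_imp_walk:
  assumes y: "unit_flow y"
  obtains p where "awalk (root D) p (terminal D)" "\<And>a. a \<in> darcs D \<Longrightarrow> y a = of_bool (a \<in> set p)"
proof -
  have y01: "y a = 0 \<or> y a = 1" if "a \<in> darcs D" for a using y that by (auto simp: unit_flow_def)
  have one_arc: "\<exists>a. {b \<in> darcs D. arc_layer D b = j \<and> y b = 1} = {a}" if "j < n" for j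
  proof -
    have "(\<Sum>a \<in> {a \<in> darcs D. arc_layer D a = j}. y a) =
          (\<Sum>a \<in> {a \<in> darcs D. arc_layer D a = j}. if y a = 1 then 1 else 0)"
      using y01 by (intro sum.cong refl) (metis (mono_tags) mem_Collect_eq)
    then have "1 = (\<Sum>a \<in> {a \<in> darcs D. arc_layer D a = j}. if y a = 1 then 1 else (0::real))"
      using unit_flow_layer_sum[OF y that] by simp
    also have "\<dots> = card {b \<in> darcs D. arc_layer D b = j \<and> y b = 1}"
      by (subst sum.inter_filter[symmetric]) (auto intro!: arg_cong[where f = card])
    finally have "card {b \<in> darcs D. arc_layer D b = j \<and> y b = 1} = 1" by simp
    then show ?thesis by (simp add: card_1_singleton_iff)
  qed
  then obtain f where f: "\<And>j. j < n \<Longrightarrow> {b \<in> darcs D. arc_layer D b = j \<and> y b = 1} = {f j}"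
    by metis
  have f_arc: "f j \<in> darcs D" "arc_layer D (f j) = j" "y (f j) = 1" if "j < n" for j
    using f[OF that] by auto
  have f_eq: "b = f (arc_layer D b)" if "b \<in> darcs D" "y b = 1" for b
    using f[OF arc_layer_less[OF that(1)]] that by auto
  have link: "dhead D (f j) = dtail D (f (Suc j))" if j: "Suc j < n" for j
  proof -
    let ?u = "dhead D (f j)"
    have fj: "f j \<in> darcs D" "arc_layer D (f j) = j" "y (f j) = 1" using f_arc[of j] j by auto
    have lu: "layer D ?u = Suc j" using layer_head fj by simp
    have "y (f j) \<le> (\<Sum>a \<in> in_arcs (graph_of D) ?u. y a)"
      using fj y01 by (intro member_le_sum) (force intro: less_imp_le)+
    also have "\<dots> = (\<Sum>a \<in> out_arcs (graph_of D) ?u. y a)"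
      using fj lu j by (subst unit_flow_conservation[OF y]) auto
    finally have "(\<Sum>a \<in> out_arcs (graph_of D) ?u. y a) \<noteq> 0" using fj by simp
    then obtain b where "b \<in> out_arcs (graph_of D) ?u" "y b \<noteq> 0"
      by (meson sum.neutral)
    then have b: "b \<in> darcs D" "dtail D b = ?u" "y b \<noteq> 0" by auto
    then have "b = f (Suc j)" using f_eq[of b] y01[of b] lu by (auto simp: arc_layer_def)
    then show ?thesis using b by simp
  qed
  have walk: "awalk (root D) (map f [0..<Suc k]) (dhead D (f k))" if "k < n" for k
    using that
  proof (induction k)
    case 0
    then have "dtail D (f 0) = root D" using f_arc[of 0] layer_0_imp_root by (auto simp: arc_layer_def)
    then show ?case using f_arc[OF 0] by (simp add: awalk_Cons_iff awalk_Nil_iff)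
  next
    case (Suc k)
    have "awalk (dhead D (f k)) [f (Suc k)] (dhead D (f (Suc k)))"
      using f_arc[OF Suc.prems] link[OF Suc.prems] by (simp add: awalk_Cons_iff awalk_Nil_iff)
    with Suc have "awalk (root D) (map f [0..<Suc k] @ [f (Suc k)]) (dhead D (f (Suc k)))"
      by (intro awalk_appendI) simp_all
    then show ?case by simp
  qed
  show thesis
  proof
    have last: "n - 1 < n" "Suc (n - 1) = n" using n_pos by auto
    have "dhead D (f (n - 1)) = terminal D"
      using f_arc[OF last(1)] layer_head[of "f (n - 1)"] last by (intro layer_n_imp_terminal) auto
    then show "awalk (root D) (map f [0..<n]) (terminal D)" using walk[OF last(1)] last by simp
    show "y a = of_bool (a \<in> set (map f [0..<n]))" if a: "a \<in> darcs D" for a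
      using y01[OF a] f_eq[OF a] arc_layer_less[OF a] f_arc(3) by (auto simp: image_iff)
  qed
qed

lemma sum_over_walk:
  fixes g :: "'e \<Rightarrow> real"
  assumes "awalk u p v" "\<And>a. a \<in> darcs D \<Longrightarrow> y a = of_bool (a \<in> set p)"
  shows "(\<Sum>a \<in> darcs D. g a * y a) = sum_list (map g p)"
proof -
  have "(\<Sum>a \<in> darcs D. g a * y a) = (\<Sum>a \<in> darcs D. if a \<in> set p then g a else 0)"
    using assms(2) by (intro sum.cong) auto
  also have "\<dots> = (\<Sum>a \<in> set p. g a)"
    using arc_in_walk[OF assms(1)] by (subst sum.inter_restrict[symmetric]) (auto intro: sum.cong)
  finally show ?thesis using awalk_distinct[OF assms(1)] by (simp add: sum_list_distinct_conv_sum_set)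
qed

end

section \<open>Diagrams encoding the follower's problem\<close>

locale encoded_follower =
  fixes P :: dts and D :: "('v, 'e) diagram"
  assumes encodes: "encodes_follower D P"
begin

sublocale layered_diagram "nvars P" D
  using encodes by unfold_locales (simp add: encodes_follower_def)

definition walk_vec :: "'e list \<Rightarrow> real vec" where
  "walk_vec p = vec_of_list (map (val D) p)"

lemma val_binary: "a \<in> darcs D \<Longrightarrow> val D a = 0 \<or> val D a = 1"
  and len_eq: "a \<in> darcs D \<Longrightarrow> len D a = (if val D a = 1 then cF P $ arc_layer D a else 0)"
  using encodes by (auto simp: encodes_follower_def)

lemma follower_set_eq: "follower_set P = walk_vec ` {p. awalk (root D) p (terminal D)}"
  using encodes unfolding encodes_follower_def bij_betw_def apath_iff_awalk walk_vec_def by auto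

lemma dim_walk_vec: "awalk (root D) p (terminal D) \<Longrightarrow> dim_vec (walk_vec p) = nvars P"
  by (simp add: walk_vec_def length_root_terminal)

lemma walk_vec_nth:
  "awalk (root D) p (terminal D) \<Longrightarrow> j < nvars P \<Longrightarrow> walk_vec p $ j = val D (p ! j)"
  by (simp add: walk_vec_def length_root_terminal vec_of_list_index)

lemma sum_list_walk:
  fixes g :: "'e \<Rightarrow> real"
  assumes "awalk (root D) p (terminal D)"
  shows "sum_list (map g p) = (\<Sum>j<nvars P. g (p ! j))"
  using length_root_terminal[OF assms] by (simp add: sum_list_sum_nth atLeast0LessThan)

lemma len_walk:
  assumes "awalk (root D) p (terminal D)"
  shows "sum_list (map (len D) p) = cF P \<bullet> walk_vec p"
proof -
  have "len D (p ! j) = cF P $ j * walk_vec p $ j" if "j < nvars P" for j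
    using nth_in_walk(2)[OF assms that] arc_layer_nth[OF assms that] walk_vec_nth[OF assms that]
      val_binary[of "p ! j"] by (auto simp: len_eq)
  then show ?thesis
    by (simp add: sum_list_walk[OF assms] scalar_prod_def dim_walk_vec[OF assms] atLeast0LessThan)
qed

text \<open>
  Translates the coupling constraint \<open>x \<le> 1 - xL\<close> into a condition on arcs: for binary vectors it
  fails in component \<open>j\<close> only if both components are 1, that is, if the path takes an interdicted
  arc in layer \<open>j\<close>.
\<close>

lemma walk_vec_response_iff:
  assumes p: "awalk (root D) p (terminal D)" and xL: "xL \<in> binary_vecs (nvars P)"
  shows "walk_vec p \<in> follower_responses P xL \<longleftrightarrow>
         (\<forall>a \<in> set p. val D a = 1 \<longrightarrow> xL $ arc_layer D a = 0)"
proof -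
  have dims: "dim_vec xL = nvars P" and xL01: "\<And>j. j < nvars P \<Longrightarrow> xL $ j = 0 \<or> xL $ j = 1"
    using xL by (auto simp: binary_vecs_def)
  have "walk_vec p \<in> follower_set P" using p by (auto simp: follower_set_eq)
  then have "walk_vec p \<in> follower_responses P xL \<longleftrightarrow> (\<forall>j<nvars P. walk_vec p $ j \<le> 1 - xL $ j)"
    using dims dim_walk_vec[OF p] by (auto simp: follower_responses_def less_eq_vec_def)
  also have "\<dots> \<longleftrightarrow> (\<forall>j<nvars P. val D (p ! j) = 1 \<longrightarrow> xL $ arc_layer D (p ! j) = 0)"
  proof (intro all_cong)
    fix j assume j: "j < nvars P"
    show "walk_vec p $ j \<le> 1 - xL $ j \<longleftrightarrow> (val D (p ! j) = 1 \<longrightarrow> xL $ arc_layer D (p ! j) = 0)"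
      using xL01[OF j] val_binary[OF nth_in_walk(2)[OF p j]]
      by (auto simp: walk_vec_nth[OF p j] arc_layer_nth[OF p j])
  qed
  also have "\<dots> \<longleftrightarrow> (\<forall>a \<in> set p. val D a = 1 \<longrightarrow> xL $ arc_layer D a = 0)"
    by (auto simp: all_set_conv_all_nth length_root_terminal[OF p])
  finally show ?thesis .
qed

text \<open>
  The only arc of layer \<open>j\<close> on the path is \<open>p ! j\<close>, which counts in the sum exactly if its value
  is 1. So the linking constraints of (MILP-DB) recover the vector encoded by the path.
\<close>

lemma one_arc_indicator_sum:
  assumes p: "awalk (root D) p (terminal D)" and j: "j < nvars P"
    and y: "\<And>a. a \<in> darcs D \<Longrightarrow> y a = of_bool (a \<in> set p)"
  shows "(\<Sum>a \<in> {a \<in> one_arcs D. arc_layer D a = j}. y a) = walk_vec p $ j"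
proof -
  have "(\<Sum>a \<in> {a \<in> one_arcs D. arc_layer D a = j}. y a) =
        (\<Sum>a \<in> {a \<in> one_arcs D. arc_layer D a = j}. if a = p ! j then 1 else 0)"
    using nth_in_walk[OF p j] arc_of_layer[OF p] by (intro sum.cong) (auto simp: y)
  also have "\<dots> = of_bool (val D (p ! j) = 1)"
    using nth_in_walk(2)[OF p j] arc_layer_nth[OF p j] by (subst sum.delta) auto
  also have "\<dots> = walk_vec p $ j"
    using val_binary[OF nth_in_walk(2)[OF p j]] by (auto simp: walk_vec_nth[OF p j])
  finally show ?thesis .
qed

section \<open>Penalised arc lengths\<close>

text \<open>
  These are the right-hand sides of the dual constraints once \<open>\<gamma> a\<close> has been set to
  \<open>M a * xL $ j\<close> and moved to the right.
\<close>

definition penalised_len :: "real vec \<Rightarrow> 'e \<Rightarrow> real" where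
  "penalised_len xL a = len D a - (if val D a = 1 then big_M P D a * xL $ arc_layer D a else 0)"

lemma big_M_nonneg:
  assumes "a \<in> one_arcs D" shows "0 \<le> big_M P D a"
proof -
  have "(\<Sum>j<nvars P. min (cF P $ j) 0) =
        min (cF P $ arc_layer D a) 0 + (\<Sum>j \<in> {..<nvars P} - {arc_layer D a}. min (cF P $ j) 0)"
    using arc_layer_less[of a] assms by (intro sum.remove) auto
  moreover have "(\<Sum>j \<in> {..<nvars P} - {arc_layer D a}. min (cF P $ j) 0) \<le> 0"
    by (intro sum_nonpos) auto
  moreover have "0 \<le> (\<Sum>j<nvars P. max (cF P $ j) 0)" by (intro sum_nonneg) auto
  moreover have "len D a = cF P $ arc_layer D a" using assms by (simp add: len_eq)
  ultimately show ?thesis unfolding big_M_def by linarith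
qed

lemma sum_min_cF_le:
  assumes "x \<in> binary_vecs (nvars P)"
  shows "(\<Sum>j<nvars P. min (cF P $ j) 0) \<le> cF P \<bullet> x"
proof -
  have "min (cF P $ j) 0 \<le> cF P $ j * x $ j" if "j < nvars P" for j
  proof -
    have "x $ j = 0 \<or> x $ j = 1" using assms that by (auto simp: binary_vecs_def)
    then show ?thesis by auto
  qed
  then show ?thesis using assms
    by (auto simp: scalar_prod_def binary_vecs_def atLeast0LessThan intro!: sum_mono)
qed

text \<open>
  The interdicted arc \<open>a\<close> has penalised length exactly \<open>T - S\<close>, with \<open>S\<close> and \<open>T\<close> the sums of the
  positive and negative parts of \<open>cF\<close>. Any other arc of the walk, in layer \<open>j\<close> say, has penalised
  length at most the positive part of \<open>cF $ j\<close>, since penalties are nonnegative. Together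
  the others make up at most \<open>S\<close>.
\<close>

lemma penalised_walk_le_sum_min:
  assumes p: "awalk (root D) p (terminal D)" and xL: "xL \<in> binary_vecs (nvars P)"
    and a: "a \<in> set p" "val D a = 1" "xL $ arc_layer D a \<noteq> 0"
  shows "sum_list (map (penalised_len xL) p) \<le> (\<Sum>j<nvars P. min (cF P $ j) 0)"
proof -
  define i where "i = arc_layer D a"
  have aD: "a \<in> darcs D" using arc_in_walk[OF p a(1)] .
  have i: "i < nvars P" "p ! i = a" using arc_layer_less[OF aD] arc_of_layer[OF p a(1)] by (auto simp: i_def)
  have xL01: "xL $ j = 0 \<or> xL $ j = 1" if "j < nvars P" for j
    using xL that by (auto simp: binary_vecs_def)
  have "xL $ i = 1" using xL01[OF i(1)] a(3) by (simp add: i_def)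
  then have hit: "penalised_len xL (p ! i) =
      (\<Sum>j<nvars P. min (cF P $ j) 0) - (\<Sum>j<nvars P. max (cF P $ j) 0)"
    using a(2) i by (simp add: penalised_len_def big_M_def i_def)
  have other: "penalised_len xL (p ! j) \<le> max (cF P $ j) 0" if j: "j < nvars P" for j
  proof -
    have pj: "p ! j \<in> darcs D" using nth_in_walk(2)[OF p j] .
    show ?thesis
      using xL01[OF j] val_binary[OF pj] big_M_nonneg[of "p ! j"] pj arc_layer_nth[OF p j]
      by (auto simp: penalised_len_def len_eq)
  qed
  have "(\<Sum>j<nvars P. max (cF P $ j) 0) =
        max (cF P $ i) 0 + (\<Sum>j\<in>{..<nvars P} - {i}. max (cF P $ j) 0)"
    using i by (intro sum.remove) auto
  then have rest: "(\<Sum>j\<in>{..<nvars P} - {i}. max (cF P $ j) 0) \<le> (\<Sum>j<nvars P. max (cF P $ j) 0)"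
    by simp
  have "sum_list (map (penalised_len xL) p) =
        penalised_len xL (p ! i) + (\<Sum>j\<in>{..<nvars P} - {i}. penalised_len xL (p ! j))"
    unfolding sum_list_walk[OF p] using i by (intro sum.remove) auto
  also have "\<dots> \<le> penalised_len xL (p ! i) + (\<Sum>j\<in>{..<nvars P} - {i}. max (cF P $ j) 0)"
    using other by (intro add_left_mono sum_mono) auto
  finally show ?thesis using hit rest by linarith
qed

text \<open>
  A path without interdicted arcs keeps its length and is an admissible response, so optimality
  of \<open>xF\<close> applies. The penalised length of any other path is at most the sum of the negative parts
  of \<open>cF\<close>, which is a lower bound for the follower value of every binary vector.
\<close>

lemma penalised_walk_le_optimum:
  assumes p: "awalk (root D) p (terminal D)" and feas: "dts_feasible P xL xF"
  shows "sum_list (map (penalised_len xL) p) \<le> cF P \<bullet> xF"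
proof -
  have xL: "xL \<in> binary_vecs (nvars P)" and xF: "xF \<in> binary_vecs (nvars P)"
    and opt: "\<And>x. x \<in> follower_responses P xL \<Longrightarrow> cF P \<bullet> x \<le> cF P \<bullet> xF"
    using feas
    by (auto simp: dts_feasible_def is_arg_max_linorder follower_responses_def follower_set_def)
  show ?thesis
  proof (cases "walk_vec p \<in> follower_responses P xL")
    case True
    then have "map (penalised_len xL) p = map (len D) p"
      using walk_vec_response_iff[OF p xL] by (auto simp: penalised_len_def)
    then show ?thesis using opt[OF True] len_walk[OF p] by (simp only:)
  next
    case False
    then obtain a where "a \<in> set p" "val D a = 1" "xL $ arc_layer D a \<noteq> 0"
      using walk_vec_response_iff[OF p xL] by auto
    then show ?thesis
      using penalised_walk_le_sum_min[OF p xL] sum_min_cF_le[OF xF] by fastforce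
  qed
qed

section \<open>The reformulation\<close>

text \<open>
  Optimality of the path of \<open>y\<close> follows from weak duality for the weights \<open>len D a - s a\<close>, where
  \<open>s\<close> is the slack of the constraint \<open>\<gamma> a \<ge> M a * xL $ j\<close>: an admissible path meets only part of
  the total slack, whereas the duality equation credits the path of \<open>y\<close> with all of it.
\<close>

lemma milp_db_feasible_imp_dts_feasible:
  assumes milp: "milp_db_feasible P D M xL xF y \<pi> \<gamma>"
  shows "dts_feasible P xL xF"
proof -
  have xL: "xL \<in> binary_vecs (nvars P)" and xF: "xF \<in> binary_vecs (nvars P)"
    and \<pi>_terminal: "\<pi> (terminal D) = 0"
    and leader: "leader_constraints P xL xF"
    and flow: "unit_flow y"
    and block: "\<And>a. a \<in> one_arcs D \<Longrightarrow> y a \<le> 1 - xL $ arc_layer D a"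
    and dual1: "\<And>a. a \<in> one_arcs D \<Longrightarrow> len D a \<le> \<pi> (dtail D a) - \<pi> (dhead D a) + \<gamma> a"
    and dual0: "\<And>a. a \<in> zero_arcs D \<Longrightarrow> 0 \<le> \<pi> (dtail D a) - \<pi> (dhead D a)"
    and xF_eq: "\<And>j. j < nvars P \<Longrightarrow> xF $ j = (\<Sum>a \<in> {a \<in> one_arcs D. arc_layer D a = j}. y a)"
    and strong: "(\<Sum>a \<in> darcs D. len D a * y a) - \<pi> (root D) - (\<Sum>a \<in> one_arcs D. \<gamma> a)
       + (\<Sum>a \<in> one_arcs D. M a * xL $ arc_layer D a) = 0"
    and slack: "\<And>a. a \<in> one_arcs D \<Longrightarrow> 0 \<le> \<gamma> a - M a * xL $ arc_layer D a"
    using milp unfolding milp_db_feasible_def unit_flow_def by auto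
  obtain p where p: "awalk (root D) p (terminal D)"
    and y: "\<And>a. a \<in> darcs D \<Longrightarrow> y a = of_bool (a \<in> set p)"
    using unit_flow_imp_walk[OF flow] by blast
  have xF_walk: "xF = walk_vec p"
    using xF one_arc_indicator_sum[OF p _ y] dim_walk_vec[OF p]
    by (intro eq_vecI) (auto simp: xF_eq binary_vecs_def)
  define s where "s a = (if val D a = 1 then \<gamma> a - M a * xL $ arc_layer D a else 0)" for a
  have s_nonneg: "0 \<le> s a" if "a \<in> darcs D" for a using slack that by (auto simp: s_def)
  have value_eq: "cF P \<bullet> xF = \<pi> (root D) + (\<Sum>a \<in> darcs D. s a)"
  proof -
    have "(\<Sum>a \<in> darcs D. s a) = (\<Sum>a \<in> one_arcs D. \<gamma> a - M a * xL $ arc_layer D a)"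
      unfolding s_def by (subst sum.inter_filter) auto
    then show ?thesis
      using strong sum_over_walk[OF p y] len_walk[OF p] xF_walk by (simp add: sum_subtractf)
  qed
  \<comment> \<open>A one-arc on the path has \<open>y a = 1\<close>, so the coupling constraint forces \<open>xL\<close> to vanish there.\<close>
  have resp: "xF \<in> follower_responses P xL"
    unfolding xF_walk walk_vec_response_iff[OF p xL]
  proof (intro ballI impI)
    fix a assume a: "a \<in> set p" "val D a = 1"
    have aD: "a \<in> darcs D" using arc_in_walk[OF p a(1)] .
    then have "xL $ arc_layer D a \<le> 0" using block[of a] a y[of a] by simp
    moreover have "xL $ arc_layer D a \<in> {0, 1}"
      using xL arc_layer_less[OF aD] by (auto simp: binary_vecs_def)
    ultimately show "xL $ arc_layer D a = 0" by auto
  qed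
  have "cF P \<bullet> x \<le> cF P \<bullet> xF" if x: "x \<in> follower_responses P xL" for x
  proof -
    obtain q where q: "awalk (root D) q (terminal D)" "x = walk_vec q"
      using x by (auto simp: follower_responses_def follower_set_eq)
    have free: "\<And>a. a \<in> set q \<Longrightarrow> val D a = 1 \<Longrightarrow> xL $ arc_layer D a = 0"
      using x walk_vec_response_iff[OF q(1) xL] q(2) by blast
    have "sum_list (map (\<lambda>a. len D a - s a) q) \<le> \<pi> (root D) - \<pi> (terminal D)"
    proof (rule walk_weight_le_potential_drop[OF q(1)])
      fix a assume a: "a \<in> set q"
      then have "a \<in> darcs D" using arc_in_walk[OF q(1)] by blast
      then show "len D a - s a \<le> \<pi> (dtail D a) - \<pi> (dhead D a)"
        using val_binary[of a] dual1[of a] dual0[of a] free[OF a] by (auto simp: s_def len_eq)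
    qed
    moreover have "sum_list (map s q) \<le> (\<Sum>a \<in> darcs D. s a)"
      using sum_mono2[of "darcs D" "set q" s] arc_in_walk[OF q(1)] s_nonneg awalk_distinct[OF q(1)]
      by (auto simp: sum_list_distinct_conv_sum_set)
    ultimately show ?thesis
      using \<pi>_terminal value_eq len_walk[OF q(1)] q(2) by (simp add: sum_list_subtractf)
  qed
  then show ?thesis
    using xL leader resp by (auto simp: dts_feasible_def is_arg_max_linorder)
qed

text \<open>
  With all slacks equal to 0 the duality equation reduces to \<open>\<pi> (root D) = cF P \<bullet> xF\<close>, which is the
  root value that \<open>potential_exists\<close> is asked for.
\<close>

lemma dts_feasible_imp_milp_db_feasible:
  assumes feas: "dts_feasible P xL xF" and M: "\<And>a. a \<in> darcs D \<Longrightarrow> M a = big_M P D a"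
  obtains y \<pi> \<gamma> where "milp_db_feasible P D M xL xF y \<pi> \<gamma>"
proof -
  have xL: "xL \<in> binary_vecs (nvars P)" and leader: "leader_constraints P xL xF"
    and resp: "xF \<in> follower_responses P xL"
    using feas by (auto simp: dts_feasible_def is_arg_max_linorder)
  have xF: "xF \<in> binary_vecs (nvars P)"
    using resp by (auto simp: follower_responses_def follower_set_def)
  have xL01: "xL $ arc_layer D a \<in> {0, 1}" if "a \<in> darcs D" for a
    using xL arc_layer_less[OF that] by (auto simp: binary_vecs_def)
  obtain p where p: "awalk (root D) p (terminal D)" and xF_walk: "xF = walk_vec p"
    using resp by (auto simp: follower_responses_def follower_set_eq)
  define y :: "'e \<Rightarrow> real" where "y a = of_bool (a \<in> set p)" for a
  define \<gamma> where "\<gamma> a = M a * xL $ arc_layer D a" for a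
  obtain \<pi> where \<pi>: "\<pi> (root D) = cF P \<bullet> xF" "\<pi> (terminal D) = 0"
    "\<And>a. a \<in> darcs D \<Longrightarrow> penalised_len xL a \<le> \<pi> (dtail D a) - \<pi> (dhead D a)"
    using potential_exists[of "penalised_len xL" "cF P \<bullet> xF"] penalised_walk_le_optimum[OF _ feas]
    by blast
  have flow: "unit_flow y" using walk_unit_flow[OF p] unfolding y_def .
  have block: "y a \<le> 1 - xL $ arc_layer D a" if "a \<in> one_arcs D" for a
  proof (cases "a \<in> set p")
    case True
    then show ?thesis using resp walk_vec_response_iff[OF p xL] xF_walk that by (simp add: y_def)
  next
    case False
    then show ?thesis using xL01[of a] that by (auto simp: y_def)
  qed
  have \<gamma>_nonneg: "0 \<le> \<gamma> a" if "a \<in> one_arcs D" for a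
    using big_M_nonneg[OF that] M[of a] xL01[of a] that by (auto simp: \<gamma>_def)
  have dual1: "\<pi> (dtail D a) - \<pi> (dhead D a) + \<gamma> a \<ge> len D a" if "a \<in> one_arcs D" for a
    using \<pi>(3)[of a] that M[of a] by (simp add: penalised_len_def \<gamma>_def)
  have dual0: "\<pi> (dtail D a) - \<pi> (dhead D a) \<ge> 0" if "a \<in> zero_arcs D" for a
    using \<pi>(3)[of a] that by (simp add: penalised_len_def len_eq)
  have xF_eq: "xF $ j = (\<Sum>a \<in> {a \<in> one_arcs D. arc_layer D a = j}. y a)" if "j < nvars P" for j
    using one_arc_indicator_sum[OF p that, of y] xF_walk by (simp add: y_def)
  have strong: "(\<Sum>a \<in> darcs D. len D a * y a) = \<pi> (root D)"
    using sum_over_walk[OF p, of y "len D"] len_walk[OF p] \<pi>(1) xF_walk by (simp add: y_def)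
  have "milp_db_feasible P D M xL xF y \<pi> \<gamma>"
    unfolding milp_db_feasible_def
    using xL xF leader flow \<pi>(2) block \<gamma>_nonneg dual1 dual0 xF_eq strong
    by (simp add: unit_flow_def \<gamma>_def[symmetric])
  then show thesis by (rule that)
qed

end

theorem proposition7:
  fixes P :: dts
    and D :: "('v, 'e) diagram"
    and M :: "'e \<Rightarrow> real"
  assumes "dts_data P"
    and "relatively_complete_recourse P"
    and "encodes_follower D P"
    and "\<forall>a \<in> darcs D. M a = big_M P D a"
  shows "valid_reformulation P D M"
proof -
  interpret encoded_follower P D using assms(3) by unfold_locales
  have "dts_feasible P xL xF \<longleftrightarrow> (\<exists>y \<pi> \<gamma>. milp_db_feasible P D M xL xF y \<pi> \<gamma>)" for xL xF
  proof
    assume "dts_feasible P xL xF"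
    then obtain y \<pi> \<gamma> where "milp_db_feasible P D M xL xF y \<pi> \<gamma>"
      using dts_feasible_imp_milp_db_feasible[of xL xF M] assms(4) by blast
    then show "\<exists>y \<pi> \<gamma>. milp_db_feasible P D M xL xF y \<pi> \<gamma>" by blast
  next
    assume "\<exists>y \<pi> \<gamma>. milp_db_feasible P D M xL xF y \<pi> \<gamma>"
    then show "dts_feasible P xL xF" using milp_db_feasible_imp_dts_feasible by blast
  qed
  then show ?thesis
    by (simp add: valid_reformulation_def milp_db_objective_def dts_objective_def)
qed

end
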